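(* Let $f=h+\overline{g}\in\mathcal{H_R}$ be a sense-preserving harmonic mapping with dilatation $\omega=g'/h'$. Then for $z\in\mathbb{D}$ with $|z|=r$, $$|g(z)|\le \begin{cases} -\log(1-r)-\dfrac{1-t}{t}\log(1+tr), & \text{when } |\omega(0)|=t\neq 0,\\[2mm] -r-\log(1-r), & \text{when } \omega(0)=0. \end{cases}$$ These inequalities are sharp, i.e. for each $t\in(0,1)$ (respectively $t=0$) and each $r\in(0,1)$ the bound cannot be improved over all $f\in\mathcal{H_R}$ with $|\omega(0)|=t$ and all $z$ with $|z|=r$.
   Context: Let $\mathbb{D}=\{z\in\mathbb{C}:|z|<1\}$. $\mathcal{A}$ is the class of analytic functions $h$ in $\mathbb{D}$ with $h(0)=0$, $h'(0)=1$. $\mathcal{H}$ is the class of all sense-preserving harmonic functions $f=h+\overline{g}$ in $\mathbb{D}$, with $h,g$ analytic in $\mathbb{D}$ of the form $h(z)=z+\sum_{n=2}^\infty a_nz^n$, $g(z)=\sum_{n=1}^\infty b_nz^n$; sense-preserving means that the Jacobian $J_f=|h'|^2-|g'|^2$ is positive in $\mathbb{D}$. The dilatation $\omega=g'/h'$ is then analytic with $|\omega|<1$ in $\mathbb{D}$. $\mathcal{R}$ is the class of functions $h\in\mathcal{A}$ such that, for some $m\in\mathbb{N}=\{1,2,3,\dots\}$, $h'(z)=\frac{m}{m-z^m}$ for all $z\in\mathbb{D}$. $\mathcal{H_R}$ is the class of all $f=h+\overline{g}\in\mathcal{H}$ with $h\in\mathcal{R}$. *)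

theory Defs
  imports "HOL-Complex_Analysis.Complex_Analysis"
begin

text \<open>
  Functions on the open unit disk are total functions on \<^typ>\<open>complex\<close> of which only the
  values in \<^term>\<open>ball 0 1 :: complex set\<close> matter.
\<close>

abbreviation unit_disk :: "complex set" (\<open>\<D>\<close>) where
  "\<D> \<equiv> ball 0 1"

definition class_A :: "(complex \<Rightarrow> complex) set" where
  "class_A = {h. h holomorphic_on \<D> \<and> h 0 = 0 \<and> deriv h 0 = 1}"

definition class_R :: "(complex \<Rightarrow> complex) set" where
  "class_R = {h \<in> class_A. \<exists>m\<ge>1. \<forall>z\<in>\<D>. deriv h z = of_nat m / (of_nat m - z ^ m)}"

text \<open>
  The decomposition f = h + cnj g on the unit disk with h and g analytic,
  h(z) = z + sum of a(n) z^n over n >= 2, and g(z) = sum of b(n) z^n over n >= 1.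
  Such an f is automatically (complex-valued) harmonic in the disk, and the
  normalisation g(0) = 0 makes h and g unique on the disk.
\<close>

definition canonical_decomposition ::
    "(complex \<Rightarrow> complex) \<Rightarrow> (complex \<Rightarrow> complex) \<Rightarrow> (complex \<Rightarrow> complex) \<Rightarrow> bool" where
  "canonical_decomposition f h g \<longleftrightarrow>
     h holomorphic_on \<D> \<and> g holomorphic_on \<D> \<and>
     (\<exists>a. \<forall>z\<in>\<D>. (\<lambda>n. a (n + 2) * z ^ (n + 2)) sums (h z - z)) \<and>
     (\<exists>b. \<forall>z\<in>\<D>. (\<lambda>n. b (n + 1) * z ^ (n + 1)) sums g z) \<and>
     (\<forall>z\<in>\<D>. f z = h z + cnj (g z))"

definition jacobian :: "(complex \<Rightarrow> complex) \<Rightarrow> (complex \<Rightarrow> complex) \<Rightarrow> complex \<Rightarrow> real" where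
  "jacobian h g z = (cmod (deriv h z))\<^sup>2 - (cmod (deriv g z))\<^sup>2"

definition dilatation ::
    "(complex \<Rightarrow> complex) \<Rightarrow> (complex \<Rightarrow> complex) \<Rightarrow> complex \<Rightarrow> complex" where
  "dilatation h g z = deriv g z / deriv h z"

definition class_H :: "(complex \<Rightarrow> complex) set" where
  "class_H = {f. \<exists>h g. canonical_decomposition f h g \<and> (\<forall>z\<in>\<D>. jacobian h g z > 0)}"

definition class_HR :: "(complex \<Rightarrow> complex) set" where
  "class_HR = {f \<in> class_H. \<exists>h g. canonical_decomposition f h g \<and> h \<in> class_R}"

definition growth_bound :: "real \<Rightarrow> real \<Rightarrow> real" where
  "growth_bound t r =
     (if t \<noteq> 0 then - ln (1 - r) - (1 - t) / t * ln (1 + t * r) else - r - ln (1 - r))"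

end

theory Submission
  imports Defs
begin

text \<open>
  The canonical decomposition is unique, because a difference of two of them is both holomorphic
  and antiholomorphic. Hence the dilatation maps the disk to itself, and
  Schwarz--Pick gives \<open>\<bar>\<omega>(z)\<bar> \<le> (t + r)/(1 + t r)\<close>, while \<open>\<bar>h'(z)\<bar> \<le> 1/(1 - r)\<close>
  for every \<open>m\<close>. The bound on \<open>\<bar>g\<bar>\<close> follows by integrating along a radius. Equality holds on
  the positive real axis for \<open>m = 1\<close> and \<open>\<omega>(z) = (t + z)/(1 + t z)\<close>.
\<close>

section \<open>Uniqueness of the canonical decomposition\<close>

lemma holomorphic_antiholomorphic_constant:
  fixes d e :: "complex \<Rightarrow> complex"
  assumes d: "d holomorphic_on S" and e: "e holomorphic_on S"
    and S: "open S" "connected S"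
    and eq: "\<And>z. z \<in> S \<Longrightarrow> d z = cnj (e z)"
  shows "d constant_on S"
proof (rule has_field_derivative_0_imp_constant_on[OF _ S(2,1)])
  fix z assume z: "z \<in> S"
  define D where "D = deriv d z"
  define E where "E = deriv e z"
  have D: "(d has_field_derivative D) (at z)"
    unfolding D_def by (rule holomorphic_derivI[OF d S(1) z])
  have E: "(e has_field_derivative E) (at z)"
    unfolding E_def by (rule holomorphic_derivI[OF e S(1) z])
  have "((\<lambda>x. cnj (e x)) has_derivative (\<lambda>k. cnj (E * k))) (at z)"
    by (rule has_derivative_cnj[OF E[unfolded has_field_derivative_def]])
  then have "(d has_derivative (\<lambda>k. cnj (E * k))) (at z)"
    by (rule has_derivative_transform_within_open[OF _ S(1) z]) (simp add: eq)
  \<comment> \<open>The real derivative of \<open>d\<close> at \<open>z\<close> is both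
    complex-linear and conjugate-linear; comparing its values at 1 and \<open>\<i>\<close> forces it
    to vanish.\<close>
  with D have fun_eq: "(*) D = (\<lambda>k. cnj (E * k))"
    unfolding has_field_derivative_def by (rule has_derivative_unique)
  have "D = cnj E" "D * \<i> = - (cnj E * \<i>)"
    using fun_cong[OF fun_eq, of 1] fun_cong[OF fun_eq, of \<i>] by simp_all
  then have "D * \<i> = - (D * \<i>)" by metis
  then have "D = 0" by simp
  with D show "(d has_field_derivative 0) (at z)" by simp
qed

text \<open>Both series have only positive exponents, so every term vanishes at 0. This is the
  normalisation that fixes the additive constant in the uniqueness argument.\<close>

lemma canonical_decomposition_zero:
  assumes "canonical_decomposition f h g"
  shows "h 0 = 0" "g 0 = 0"
proof -
  obtain a b where a: "\<And>z. z \<in> \<D> \<Longrightarrow> (\<lambda>n. a (n + 2) * z ^ (n + 2)) sums (h z - z)"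
    and b: "\<And>z. z \<in> \<D> \<Longrightarrow> (\<lambda>n. b (n + 1) * z ^ (n + 1)) sums g z"
    using assms unfolding canonical_decomposition_def by blast
  show "h 0 = 0" "g 0 = 0"
    using sums_unique[OF a[of 0]] sums_unique[OF b[of 0]] by simp_all
qed

lemma canonical_decomposition_unique:
  assumes 1: "canonical_decomposition f h g" and 2: "canonical_decomposition f h' g'"
    and z: "z \<in> \<D>"
  shows "h z = h' z" "g z = g' z"
proof -
  have hol: "h holomorphic_on \<D>" "g holomorphic_on \<D>" "h' holomorphic_on \<D>" "g' holomorphic_on \<D>"
    and f: "\<And>w. w \<in> \<D> \<Longrightarrow> h w + cnj (g w) = h' w + cnj (g' w)"
    using 1 2 by (auto simp: canonical_decomposition_def)
  have eq: "h w - h' w = cnj (g' w - g w)" if "w \<in> \<D>" for w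
    using f[OF that] by (simp add: algebra_simps)
  have "(\<lambda>w. h w - h' w) constant_on \<D>"
    by (rule holomorphic_antiholomorphic_constant[where e = "\<lambda>w. g' w - g w"])
       (use hol eq in \<open>auto intro!: holomorphic_intros\<close>)
  then have "h z - h' z = h 0 - h' 0"
    using z unfolding constant_on_def by (metis centre_in_ball zero_less_one)
  then show "h z = h' z"
    using canonical_decomposition_zero[OF 1] canonical_decomposition_zero[OF 2] by simp
  then show "g z = g' z"
    using f[OF z] by simp
qed

lemma canonical_decompositionI:
  assumes h: "h holomorphic_on \<D>" "h 0 = 0" "deriv h 0 = 1"
    and g: "g holomorphic_on \<D>" "g 0 = 0"
    and f: "\<And>z. z \<in> \<D> \<Longrightarrow> f z = h z + cnj (g z)"
  shows "canonical_decomposition f h g"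
  unfolding canonical_decomposition_def
proof (intro conjI exI ballI)
  fix z assume z: "z \<in> \<D>"
  \<comment> \<open>The coefficients are the Taylor coefficients at 0; the normalisation of
    \<open>h\<close> makes the two terms split off equal to 0 and \<open>z\<close>.\<close>
  show "(\<lambda>n. (deriv ^^ (n + 2)) h 0 / fact (n + 2) * z ^ (n + 2)) sums (h z - z)"
    using sums_split_initial_segment[OF holomorphic_power_series[OF h(1) z], of 2] h(2,3)
    by (simp add: numeral_2_eq_2)
  show "(\<lambda>n. (deriv ^^ (n + 1)) g 0 / fact (n + 1) * z ^ (n + 1)) sums g z"
    using sums_split_initial_segment[OF holomorphic_power_series[OF g(1) z], of 1] g(2)
    by simp
qed (use assms in auto)

text \<open>\<open>class_H\<close> and \<open>class_HR\<close> each assert the existence of some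
  decomposition, possibly different ones. By uniqueness both agree with the given \<open>h\<close>
  and \<open>g\<close> on the open disk, hence so do the derivatives, and both properties
  transfer.\<close>

lemma class_HR_decompositionD:
  assumes f: "f \<in> class_HR" and dec: "canonical_decomposition f h g"
  shows "\<exists>m\<ge>1. \<forall>z\<in>\<D>. deriv h z = of_nat m / (of_nat m - z ^ m)"
    and "\<And>z. z \<in> \<D> \<Longrightarrow> cmod (deriv g z) < cmod (deriv h z)"
proof -
  have deriv_eq: "deriv h z = deriv h' z" "deriv g z = deriv g' z"
    if "canonical_decomposition f h' g'" "z \<in> \<D>" for h' g' z
    using canonical_decomposition_unique[OF dec that(1)] dec that
    by (auto simp: canonical_decomposition_def intro!: complex_derivative_transform_within_open)
  obtain h2 g2 where 2: "canonical_decomposition f h2 g2" "h2 \<in> class_R"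
    using f by (auto simp: class_HR_def)
  then show "\<exists>m\<ge>1. \<forall>z\<in>\<D>. deriv h z = of_nat m / (of_nat m - z ^ m)"
    using deriv_eq(1)[OF 2(1)] by (auto simp: class_R_def)
  obtain h1 g1 where 1: "canonical_decomposition f h1 g1" "\<And>z. z \<in> \<D> \<Longrightarrow> jacobian h1 g1 z > 0"
    using f by (auto simp: class_HR_def class_H_def)
  show "cmod (deriv g z) < cmod (deriv h z)" if "z \<in> \<D>" for z
    using 1(2)[OF that] deriv_eq[OF 1(1) that]
    by (auto simp: jacobian_def intro: power_less_imp_less_base)
qed

section \<open>Pointwise bounds for the dilatation and for the derivative of the analytic
  part\<close>

lemma Schwarz_Pick_growth:
  assumes hol: "\<omega> holomorphic_on \<D>" and lt1: "\<And>z. z \<in> \<D> \<Longrightarrow> cmod (\<omega> z) < 1"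
    and z: "z \<in> \<D>"
  shows "cmod (\<omega> z) \<le> (cmod (\<omega> 0) + cmod z) / (1 + cmod (\<omega> 0) * cmod z)"
proof -
  define a where "a = \<omega> 0"
  define u where "u = \<omega> z"
  define r where "r = cmod z"
  have a: "cmod a < 1" and u: "cmod u < 1" and r: "0 \<le> r" "r < 1"
    using lt1 z by (auto simp: a_def u_def r_def)
  \<comment> \<open>Composing with the disk automorphism that sends \<open>a\<close> to 0 makes the
    Schwarz lemma applicable.\<close>
  have "cmod ((Moebius_function 0 a \<circ> \<omega>) z) \<le> cmod z"
  proof (rule Schwarz_Lemma)
    show "Moebius_function 0 a \<circ> \<omega> holomorphic_on ball 0 1"
      by (rule holomorphic_on_compose_gen[OF hol Moebius_function_holomorphic[OF a]])
         (use lt1 in auto)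
    show "(Moebius_function 0 a \<circ> \<omega>) 0 = 0"
      by (simp add: a_def Moebius_function_eq_zero)
    show "cmod ((Moebius_function 0 a \<circ> \<omega>) w) < 1" if "cmod w < 1" for w
      using Moebius_function_norm_lt_1[OF a lt1[of w]] that by simp
    show "cmod z < 1" using z by simp
  qed
  then have le: "cmod ((u - a) / (1 - cnj a * u)) \<le> r"
    by (simp add: Moebius_function_simple u_def r_def)
  have prod: "cmod a * cmod u < 1"
    using mult_strict_mono'[OF a u] by simp
  then have "cmod (cnj a * u) \<noteq> cmod 1"
    by (simp add: norm_mult)
  then have "1 - cnj a * u \<noteq> 0"
    by auto
  define c where "c = Re (cnj a * u)"
  from le \<open>1 - cnj a * u \<noteq> 0\<close> have "cmod (u - a) \<le> r * cmod (1 - cnj a * u)"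
    by (simp add: norm_divide pos_divide_le_eq)
  then have "(cmod (u - a))\<^sup>2 \<le> r\<^sup>2 * (cmod (1 - cnj a * u))\<^sup>2"
    using power_mono[of "cmod (u - a)" "r * cmod (1 - cnj a * u)" 2]
    by (simp add: power_mult_distrib)
  moreover have "(cmod (u - a))\<^sup>2 = (cmod u)\<^sup>2 + (cmod a)\<^sup>2 - 2 * c"
    unfolding c_def cmod_power2 by (simp add: power2_eq_square algebra_simps)
  moreover have "(cmod (1 - cnj a * u))\<^sup>2 = 1 + (cmod a * cmod u)\<^sup>2 - 2 * c"
    unfolding c_def power_mult_distrib cmod_power2 by (simp add: power2_eq_square algebra_simps)
  ultimately have "(cmod u)\<^sup>2 + (cmod a)\<^sup>2 - 2 * c \<le> r\<^sup>2 * (1 + (cmod a * cmod u)\<^sup>2 - 2 * c)"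
    by simp
  \<comment> \<open>After squaring, the arguments of \<open>a\<close> and \<open>u\<close> enter
    only through \<open>c\<close>. Collected on the right, \<open>c\<close> has the nonnegative
    coefficient \<open>2 * (1 - r\<^sup>2)\<close>, so it may be replaced by its maximum
    \<open>cmod a * cmod u\<close>; both sides then become perfect squares.\<close>
  moreover have "(1 - r\<^sup>2) * c \<le> (1 - r\<^sup>2) * (cmod a * cmod u)"
  proof (rule mult_left_mono)
    show "c \<le> cmod a * cmod u"
      unfolding c_def using complex_Re_le_cmod[of "cnj a * u"] by (simp add: norm_mult)
    show "0 \<le> 1 - r\<^sup>2" using r by (simp add: power_le_one)
  qed
  ultimately have "(cmod u - cmod a)\<^sup>2 \<le> (r * (1 - cmod a * cmod u))\<^sup>2"
    by (simp add: power2_eq_square algebra_simps)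
  then have "cmod u - cmod a \<le> r * (1 - cmod a * cmod u)"
    by (rule power2_le_imp_le) (use r prod in simp)
  moreover have "0 < 1 + cmod a * r"
    using r by (simp add: add_pos_nonneg)
  ultimately have "cmod u \<le> (cmod a + r) / (1 + cmod a * r)"
    by (simp add: pos_le_divide_eq algebra_simps)
  then show ?thesis by (simp add: u_def a_def r_def)
qed

text \<open>With \<open>r = cmod z\<close>, the chain \<open>r ^ m \<le> r \<le> m * r\<close>
  bounds the denominator below by \<open>m * (1 - r)\<close>, and the factor \<open>m\<close>
  cancels: \<open>m = 1\<close> is the worst case.\<close>

lemma cmod_of_nat_div_of_nat_minus_power_le:
  assumes z: "cmod z < 1" and m: "m \<ge> 1"
  shows "cmod (of_nat m / (of_nat m - z ^ m)) \<le> 1 / (1 - cmod z)"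
proof -
  define r where "r = cmod z"
  have r: "0 \<le> r" "r < 1" using z by (auto simp: r_def)
  have "r ^ m \<le> r ^ 1" using r m by (intro power_decreasing) auto
  also have "\<dots> \<le> real m * r" using r m by (simp add: mult_le_cancel_right1)
  finally have "real m * (1 - r) \<le> real m - r ^ m" by (simp add: algebra_simps)
  also have "\<dots> \<le> cmod (of_nat m - z ^ m)"
    using norm_triangle_ineq2[of "of_nat m" "z ^ m"] by (simp add: norm_power r_def)
  finally have le: "real m * (1 - r) \<le> cmod (of_nat m - z ^ m)" .
  have "0 < real m * (1 - r)" using r m by simp
  with le r show ?thesis
    by (simp add: norm_divide divide_simps r_def[symmetric])
qed

section \<open>The radial growth estimate\<close>

lemma growth_bound_zero [simp]: "growth_bound t 0 = 0"
  by (simp add: growth_bound_def)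

text \<open>The derivative is the product of the Schwarz-Pick bound
  \<open>(t + s) / (1 + t * s)\<close> and the bound \<open>1 / (1 - s)\<close> for the derivative
  of \<open>h\<close>. For nonzero \<open>t\<close> the logarithms come from its partial fractions;
  at \<open>t = 0\<close> it degenerates to \<open>s / (1 - s)\<close>.\<close>

lemma growth_bound_has_real_derivative:
  assumes t: "0 \<le> t" and s: "0 \<le> s" "s < 1"
  shows "(growth_bound t has_real_derivative (t + s) / ((1 + t * s) * (1 - s))) (at s)"
proof (cases "t = 0")
  case True
  have "((\<lambda>s. - s - ln (1 - s)) has_real_derivative s / (1 - s)) (at s)"
    using s by (auto intro!: derivative_eq_intros simp: field_simps)
  moreover have "growth_bound t = (\<lambda>s. - s - ln (1 - s))"
    using True by (auto simp: growth_bound_def)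
  ultimately show ?thesis using True by simp
next
  case False
  have pos: "1 + t * s > 0" using t s by (simp add: add_pos_nonneg)
  have "((\<lambda>s. - ln (1 - s) - (1 - t) / t * ln (1 + t * s)) has_real_derivative
      1 / (1 - s) - (1 - t) / t * (t / (1 + t * s))) (at s)"
    using s pos by (auto intro!: derivative_eq_intros)
  also have "1 / (1 - s) - (1 - t) / t * (t / (1 + t * s)) = (t + s) / ((1 + t * s) * (1 - s))"
    using s pos False by (simp add: divide_simps) (simp add: algebra_simps)
  also have "(\<lambda>s. - ln (1 - s) - (1 - t) / t * ln (1 + t * s)) = growth_bound t"
    using False by (auto simp: growth_bound_def)
  finally show ?thesis .
qed

lemma class_HR_growth:
  assumes f: "f \<in> class_HR" and dec: "canonical_decomposition f h g" and z: "z \<in> \<D>"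
  shows "cmod (g z) \<le> growth_bound (cmod (dilatation h g 0)) (cmod z)"
proof (cases "z = 0")
  case True
  then show ?thesis using canonical_decomposition_zero[OF dec] by simp
next
  case False
  define \<omega> where "\<omega> = dilatation h g"
  define t where "t = cmod (\<omega> 0)"
  \<comment> \<open>The unit direction of the radius through \<open>z\<close>; the point 0, where
    \<open>sgn\<close> gives 0, has been treated separately.\<close>
  define e where "e = sgn z"
  have e: "cmod e = 1" and z_eq: "z = of_real (cmod z) * e"
    using False by (simp_all add: e_def norm_sgn) (simp add: sgn_eq)
  have hol: "h holomorphic_on \<D>" "g holomorphic_on \<D>"
    using dec by (auto simp: canonical_decomposition_def)
  obtain m where m: "m \<ge> 1" "\<And>z. z \<in> \<D> \<Longrightarrow> deriv h z = of_nat m / (of_nat m - z ^ m)"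
    using class_HR_decompositionD(1)[OF f dec] by blast
  note lt = class_HR_decompositionD(2)[OF f dec]
  have nz: "deriv h w \<noteq> 0" if "w \<in> \<D>" for w
    using lt[OF that] by auto
  have \<omega>: "\<omega> holomorphic_on \<D>" "\<And>w. w \<in> \<D> \<Longrightarrow> cmod (\<omega> w) < 1"
    using hol nz lt unfolding \<omega>_def dilatation_def
    by (auto intro!: holomorphic_intros simp: norm_divide)
  have g': "cmod (deriv g w) \<le> (t + cmod w) / ((1 + t * cmod w) * (1 - cmod w))" if w: "w \<in> \<D>" for w
  proof -
    have "cmod (deriv g w) = cmod (\<omega> w) * cmod (deriv h w)"
      using nz[OF w] by (simp add: \<omega>_def dilatation_def norm_divide)
    also have "\<dots> \<le> (t + cmod w) / (1 + t * cmod w) * (1 / (1 - cmod w))"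
      using Schwarz_Pick_growth[OF \<omega> w] cmod_of_nat_div_of_nat_minus_power_le[OF _ m(1)] w m(2)[OF w]
      by (intro mult_mono) (auto simp: t_def)
    finally show ?thesis by simp
  qed
  have t: "t \<ge> 0" by (simp add: t_def)
  have ray: "of_real s * e \<in> \<D>" if "0 \<le> s" "s \<le> cmod z" for s
    using that z e by (simp add: norm_mult)
  have "((\<lambda>s. g (of_real s * e)) has_vector_derivative e * deriv g (of_real s * e)) (at s)"
    if "0 \<le> s" "s \<le> cmod z" for s
  proof -
    have "((\<lambda>s. of_real s * e) has_vector_derivative e) (at s)"
      by (auto intro!: derivative_eq_intros simp: has_vector_derivative_def scaleR_conv_of_real)
    moreover have "(g has_field_derivative deriv g (of_real s * e)) (at (of_real s * e))"
      by (rule holomorphic_derivI[OF hol(2) _ ray[OF that]]) simp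
    ultimately show ?thesis
      using field_vector_diff_chain_at[of "\<lambda>s. of_real s * e" e s g] by (simp add: o_def)
  qed
  note dg = this
  have dG: "(growth_bound t has_vector_derivative (t + s) / ((1 + t * s) * (1 - s))) (at s)"
    if "0 \<le> s" "s \<le> cmod z" for s
    using growth_bound_has_real_derivative[OF t, of s] that z
    by (simp add: has_real_derivative_iff_has_vector_derivative)
  \<comment> \<open>A mean value inequality takes the place of the integral: along the radius the
    speed of \<open>g\<close> is at most the derivative of \<open>growth_bound t\<close>, and both
    functions start at 0.\<close>
  have "norm (g (of_real (cmod z) * e) - g (of_real 0 * e)) \<le> growth_bound t (cmod z) - growth_bound t 0"
  proof (rule differentiable_bound_general)
    show "continuous_on {0..cmod z} (\<lambda>s. g (of_real s * e))"
      by (rule continuous_at_imp_continuous_on)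
         (use has_vector_derivative_continuous[OF dg] in auto)
    show "continuous_on {0..cmod z} (growth_bound t)"
      by (rule continuous_at_imp_continuous_on)
         (use has_vector_derivative_continuous[OF dG] in auto)
    show "norm (e * deriv g (of_real s * e)) \<le> (t + s) / ((1 + t * s) * (1 - s))"
      if "0 < s" "s < cmod z" for s
      using g'[OF ray[of s]] that e by (simp add: norm_mult)
  qed (use False dg dG in auto)
  then show ?thesis
    using z_eq canonical_decomposition_zero[OF dec] by (simp add: t_def \<omega>_def)
qed

section \<open>Sharpness: the extremal mapping\<close>

lemma cmod_add_less_cmod_one_add_mult:
  fixes t :: real
  assumes t: "0 \<le> t" "t < 1" and z: "cmod z < 1"
  shows "cmod (of_real t + z) < cmod (1 + of_real t * z)"
proof (rule power2_less_imp_less)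
  \<comment> \<open>This product is exactly the difference of the two squared moduli. The lemma
    makes the extremal dilatation \<open>(t + z) / (1 + t * z)\<close> a self-map of the
    disk.\<close>
  have "0 < (1 - t\<^sup>2) * (1 - (cmod z)\<^sup>2)"
    using assms by (intro mult_pos_pos) (simp_all add: power_less_one_iff abs_square_less_1)
  also have "\<dots> = (cmod (1 + of_real t * z))\<^sup>2 - (cmod (of_real t + z))\<^sup>2"
    unfolding cmod_power2 by (simp add: power2_eq_square algebra_simps)
  finally show "(cmod (of_real t + z))\<^sup>2 < (cmod (1 + of_real t * z))\<^sup>2" by simp
qed simp

lemma growth_bound_attained:
  assumes t: "0 \<le> t" "t < 1" and r: "0 < r" "r < 1"
  obtains f h g where "f \<in> class_HR" "canonical_decomposition f h g"
    "cmod (dilatation h g 0) = t" "g (of_real r) = of_real (growth_bound t r)"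
proof -
  \<comment> \<open>\<open>h\<close> is the case \<open>m = 1\<close> of \<open>class_R\<close>, and
    \<open>g\<close> is \<open>growth_bound t\<close> with the real radius replaced by a complex
    variable, so the two agree on the positive radius.\<close>
  define h where "h z = - Ln (1 - z)" for z
  define g where "g z = - Ln (1 - z) -
    (if t = 0 then z else (1 - of_real t) / of_real t * Ln (1 + of_real t * z))" for z
  define f where "f z = h z + cnj (g z)" for z
  \<comment> \<open>Positive real parts keep both arguments of \<open>Ln\<close> off its branch cut
    and the denominators nonzero.\<close>
  have Re_pos: "0 < Re (1 - z)" "0 < Re (1 + of_real t * z)" if "z \<in> \<D>" for z
  proof -
    have z: "\<bar>Re z\<bar> < 1" using that abs_Re_le_cmod[of z] by simp
    then show "0 < Re (1 - z)" by simp
    have "\<bar>t * Re z\<bar> < 1"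
      using mult_strict_mono'[of t 1 "\<bar>Re z\<bar>" 1] t z by (simp add: abs_mult)
    then show "0 < Re (1 + of_real t * z)" by simp
  qed
  have nz: "1 - z \<noteq> 0" "1 + of_real t * z \<noteq> 0" if "z \<in> \<D>" for z
    using Re_pos[OF that] by (metis less_irrefl zero_complex.sel(1))+
  have nonpos: "1 - z \<notin> \<real>\<^sub>\<le>\<^sub>0" "1 + of_real t * z \<notin> \<real>\<^sub>\<le>\<^sub>0" if "z \<in> \<D>" for z
    using Re_pos[OF that] by (auto simp: complex_nonpos_Reals_iff)
  have dh: "(h has_field_derivative 1 / (1 - z)) (at z)" if "z \<in> \<D>" for z
    unfolding h_def using nonpos[OF that] by (auto intro!: derivative_eq_intros simp: divide_inverse)
  have dg: "(g has_field_derivative (of_real t + z) / ((1 + of_real t * z) * (1 - z))) (at z)"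
    if "z \<in> \<D>" for z
  proof (cases "t = 0")
    case True
    then show ?thesis unfolding g_def using nonpos[OF that] nz[OF that]
      by (auto intro!: derivative_eq_intros simp: field_simps)
  next
    case False
    have "(g has_field_derivative 1 / (1 - z) -
        (1 - of_real t) / of_real t * (of_real t / (1 + of_real t * z))) (at z)"
      unfolding g_def using nonpos[OF that] False
      by (auto intro!: derivative_eq_intros simp: divide_inverse)
    also have "1 / (1 - z) - (1 - of_real t) / of_real t * (of_real t / (1 + of_real t * z))
        = (of_real t + z) / ((1 + of_real t * z) * (1 - z))"
      using nz[OF that] False by (simp add: divide_simps) (simp add: algebra_simps)
    finally show ?thesis .
  qed
  have h': "deriv h z = 1 / (1 - z)" if "z \<in> \<D>" for z
    using dh[OF that] by (rule DERIV_imp_deriv)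
  have g': "deriv g z = (of_real t + z) / ((1 + of_real t * z) * (1 - z))" if "z \<in> \<D>" for z
    using dg[OF that] by (rule DERIV_imp_deriv)
  have hol: "h holomorphic_on \<D>" "g holomorphic_on \<D>"
    unfolding holomorphic_on_open[OF open_ball] using dh dg by blast+
  have zeros: "h 0 = 0" "g 0 = 0" by (auto simp: h_def g_def)
  have dec: "canonical_decomposition f h g"
    by (rule canonical_decompositionI) (use hol zeros h' in \<open>auto simp: f_def\<close>)
  have "h \<in> class_R"
    unfolding class_R_def class_A_def using hol zeros h' by (auto intro!: exI[of _ 1])
  moreover have "jacobian h g z > 0" if z: "z \<in> \<D>" for z
  proof -
    have "cmod (of_real t + z) < cmod (1 + of_real t * z)"
      using cmod_add_less_cmod_one_add_mult[OF t] z by simp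
    then have "cmod (deriv g z) < cmod (deriv h z)"
      using nz[OF z] by (simp add: h'[OF z] g'[OF z] norm_divide norm_mult divide_simps)
    then show ?thesis
      by (simp add: jacobian_def power_strict_mono)
  qed
  ultimately have "f \<in> class_HR"
    using dec unfolding class_HR_def class_H_def by blast
  moreover have "cmod (dilatation h g 0) = t"
    using t by (simp add: dilatation_def h' g')
  moreover have "g (of_real r) = of_real (growth_bound t r)"
  proof -
    have "Ln (1 - of_real r) = of_real (ln (1 - r))"
      using r Ln_of_real[of "1 - r"] by simp
    moreover have "Ln (1 + of_real t * of_real r) = of_real (ln (1 + t * r))"
      using t r Ln_of_real[of "1 + t * r"] by (simp add: add_pos_nonneg)
    ultimately show ?thesis by (simp add: g_def growth_bound_def)
  qed
  ultimately show ?thesis using dec that by blast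
qed

theorem theorem2p5:
  shows "(\<forall>f h g. f \<in> class_HR \<longrightarrow> canonical_decomposition f h g \<longrightarrow>
            (\<forall>z\<in>\<D>. cmod (g z) \<le> growth_bound (cmod (dilatation h g 0)) (cmod z)))
       \<and> (\<forall>t r C :: real. 0 \<le> t \<longrightarrow> t < 1 \<longrightarrow> 0 < r \<longrightarrow> r < 1 \<longrightarrow>
            (\<forall>f h g z. f \<in> class_HR \<longrightarrow> canonical_decomposition f h g \<longrightarrow>
               cmod (dilatation h g 0) = t \<longrightarrow> cmod z = r \<longrightarrow> cmod (g z) \<le> C) \<longrightarrow>
            growth_bound t r \<le> C)"
proof (intro conjI allI impI ballI)
  fix f h g z
  assume "f \<in> class_HR" "canonical_decomposition f h g" "z \<in> \<D>"
  then show "cmod (g z) \<le> growth_bound (cmod (dilatation h g 0)) (cmod z)"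
    by (rule class_HR_growth)
next
  fix t r C :: real
  assume t: "0 \<le> t" "t < 1" and r: "0 < r" "r < 1"
    and C: "\<forall>f h g z. f \<in> class_HR \<longrightarrow> canonical_decomposition f h g \<longrightarrow>
               cmod (dilatation h g 0) = t \<longrightarrow> cmod z = r \<longrightarrow> cmod (g z) \<le> C"
  obtain f h g where "f \<in> class_HR" "canonical_decomposition f h g"
    "cmod (dilatation h g 0) = t" and g: "g (of_real r) = of_real (growth_bound t r)"
    using growth_bound_attained[OF t r] .
  \<comment> \<open>The arbitrary uniform bound \<open>C\<close> is tested on the extremal mapping
    at the positive real point of modulus \<open>r\<close>.\<close>
  then have "cmod (g (of_real r)) \<le> C"
    using C r by (metis abs_of_pos norm_of_real)
  then show "growth_bound t r \<le> C"
    by (simp add: g)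
qed

end
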